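(* Let $S$ be the set of all triangles $ABC$ with $\gamma = |\overline{AB}| = \beta = |\overline{AC}| \neq \alpha = |\overline{BC}|$ such that the side lengths $\alpha,\beta,\gamma$ are integers, the area $E$ is an integer, and the three external radii $\rho_\alpha,\rho_\beta,\rho_\gamma$ are also integers. Then $S$ is the union of the following two families: $F_1$: the triangles with $\beta=\gamma=Kn(m^2+n^2)$, $\alpha=2Kn(m^2-n^2)$; in this family the radii are given by $\rho_\alpha=Km(m^2-n^2)$, $\rho_\beta=\rho_\gamma=2Kmn^2$; $F_2$: the triangles with $\beta=\gamma=L(m-n)(m^2+n^2)$, $\alpha=4L(m-n)mn$; in this family the radii are given by $\rho_\alpha=2Lmn(m+n)$, $\rho_\beta=\rho_\gamma=L(m+n)(m-n)^2$; where $K$ and $L$ are arbitrary positive integers, and $m,n$ can be any two relatively prime positive integers of different parities (one even, the other odd) with $m>n$.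
   Context: Triangles are (nondegenerate) triangles in the Euclidean plane. For a triangle $ABC$ with side lengths $\alpha=|\overline{BC}|$, $\beta=|\overline{AC}|$, $\gamma=|\overline{AB}|$, semi-perimeter $s=\frac{\alpha+\beta+\gamma}{2}$ and area $E$, the external radii $\rho_\alpha,\rho_\beta,\rho_\gamma$ are the radii of the three exterior circles (excircles): $\rho_\alpha$ is the radius of the circle outside the triangle which is tangent to the side $\overline{BC}$ and to the two straight lines containing the other two sides (but not to those sides themselves), and $\rho_\beta,\rho_\gamma$ are defined likewise for the sides $\overline{AC}$ and $\overline{AB}$. Equivalently, $\rho_\alpha=\frac{E}{s-\alpha}$, $\rho_\beta=\frac{E}{s-\beta}$, $\rho_\gamma=\frac{E}{s-\gamma}$. *)

theory Defs
  imports "HOL-Analysis.Analysis"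
begin

type_synonym point = "real ^ 2"

definition is_triangle :: "point \<Rightarrow> point \<Rightarrow> point \<Rightarrow> bool" where
  "is_triangle A B C \<longleftrightarrow> \<not> collinear {A, B, C}"

definition area :: "point \<Rightarrow> point \<Rightarrow> point \<Rightarrow> real" where
  "area A B C = measure lebesgue (convex hull {A, B, C})"

text \<open>The circle with centre \<open>P\<close> and radius \<open>r\<close> is tangent at \<open>T\<close> to the line through
  the distinct points \<open>X\<close> and \<open>Y\<close>.\<close>
definition tangent_at :: "point \<Rightarrow> real \<Rightarrow> point \<Rightarrow> point \<Rightarrow> point \<Rightarrow> bool" where
  "tangent_at P r X Y T \<longleftrightarrow> sphere P r \<inter> affine hull {X, Y} = {T}"

text \<open>The excircle opposite the first vertex \<open>A\<close>. That it lies outside the triangle is expressed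
  with the open disc, as the circle itself meets the triangle at its point of tangency with the
  side \<open>BC\<close>.\<close>
definition is_excircle :: "point \<Rightarrow> point \<Rightarrow> point \<Rightarrow> point \<Rightarrow> real \<Rightarrow> bool" where
  "is_excircle A B C P r \<longleftrightarrow>
     r > 0 \<and>
     ball P r \<inter> convex hull {A, B, C} = {} \<and>
     (\<exists>T \<in> closed_segment B C. tangent_at P r B C T) \<and>
     (\<exists>T. T \<notin> closed_segment A B \<and> tangent_at P r A B T) \<and>
     (\<exists>T. T \<notin> closed_segment A C \<and> tangent_at P r A C T)"

definition exradius :: "point \<Rightarrow> point \<Rightarrow> point \<Rightarrow> real" where
  "exradius A B C = (THE r. \<exists>P. is_excircle A B C P r)"

definition S :: "(point \<times> point \<times> point) set" where
  "S = {(A, B, C). is_triangle A B C \<and>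
         dist A B = dist A C \<and> dist A C \<noteq> dist B C \<and>
         dist B C \<in> \<int> \<and> dist A C \<in> \<int> \<and> dist A B \<in> \<int> \<and>
         area A B C \<in> \<int> \<and>
         exradius A B C \<in> \<int> \<and> exradius B C A \<in> \<int> \<and> exradius C A B \<in> \<int>}"

definition admissible :: "nat \<Rightarrow> nat \<Rightarrow> bool" where
  "admissible m n \<longleftrightarrow> 0 < n \<and> n < m \<and> coprime m n \<and> (even m \<longleftrightarrow> odd n)"

definition family1 :: "nat \<Rightarrow> nat \<Rightarrow> nat \<Rightarrow> (point \<times> point \<times> point) set" where
  "family1 K m n = {(A, B, C). is_triangle A B C \<and>
     dist A C = real K * real n * ((real m)\<^sup>2 + (real n)\<^sup>2) \<and>
     dist A B = real K * real n * ((real m)\<^sup>2 + (real n)\<^sup>2) \<and>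
     dist B C = 2 * real K * real n * ((real m)\<^sup>2 - (real n)\<^sup>2)}"

definition family2 :: "nat \<Rightarrow> nat \<Rightarrow> nat \<Rightarrow> (point \<times> point \<times> point) set" where
  "family2 L m n = {(A, B, C). is_triangle A B C \<and>
     dist A C = real L * (real m - real n) * ((real m)\<^sup>2 + (real n)\<^sup>2) \<and>
     dist A B = real L * (real m - real n) * ((real m)\<^sup>2 + (real n)\<^sup>2) \<and>
     dist B C = 4 * real L * (real m - real n) * real m * real n}"

definition F1 :: "(point \<times> point \<times> point) set" where
  "F1 = {t. \<exists>K m n. 0 < K \<and> admissible m n \<and> t \<in> family1 K m n}"

definition F2 :: "(point \<times> point \<times> point) set" where
  "F2 = {t. \<exists>L m n. 0 < L \<and> admissible m n \<and> t \<in> family2 L m n}"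

end

theory Submission
  imports Defs
begin

text \<open>
  Let the triangle have legs \<open>b\<close>, base \<open>2c\<close> and height \<open>h\<close>, so \<open>b\<^sup>2 = c\<^sup>2 + h\<^sup>2\<close>. Its exradii are \<open>h\<close> at the
  base vertices and \<open>c h / (b - c)\<close> at the apex, and its area is \<open>c h\<close>
  (\<open>isosceles_measures\<close>). If base, legs and exradii are integers, then \<open>4 b\<^sup>2 = (2c)\<^sup>2 + 4 h\<^sup>2\<close> makes
  the base even, and the problem becomes: find the Pythagorean triples \<open>(c, h, b)\<close> in which \<open>b - c\<close>
  divides \<open>c h\<close>.

  Write \<open>h / (b - c) = p / q\<close> in lowest terms. As \<open>h\<^sup>2 = (b - c)(b + c)\<close>, also \<open>(b + c) / h = p / q\<close>,
  which forces \<open>b - c = q\<^sup>2 f\<close>, \<open>h = p q f\<close> and \<open>b + c = p\<^sup>2 f\<close> for an integer \<open>f\<close>. The apex radius is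
  \<open>c p / q\<close>, so the remaining condition is just \<open>q dvd c\<close>. If \<open>p\<close> and \<open>q\<close> have different parities, then
  \<open>f\<close> is even, \<open>q\<close> divides \<open>f / 2\<close>, and \<open>(m, n) = (p, q)\<close> gives the first family. If both are odd,
  then \<open>q\<close> divides \<open>f\<close>, and \<open>m = (p + q) / 2\<close>, \<open>n = (p - q) / 2\<close> gives the second
  (\<open>isosceles_integral_parametrization\<close>). Conversely the formulas for the radii show that both
  families are integral, and no member is equilateral because \<open>m\<^sup>2 + n\<^sup>2\<close> is odd.

  What remains is to compute the radius of a circle that is given only by its tangency conditions
  (\<open>exradius_eq\<close>). Comparing the two tangent segments at each vertex shows that the tangent from the
  vertex opposite to the touched side has length \<open>s\<close>, the semi-perimeter. This fixes the inner
  products of the centre with the two sides at that vertex, hence the centre and the radius.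
  Conversely the point with the barycentric coordinates \<open>(-a, b, c)\<close> is the centre of such a circle.
\<close>

section \<open>Tangent circles and triangles\<close>

text \<open>
  If a circle meets a line only in \<open>T\<close>, its radius to \<open>T\<close> is perpendicular to the line: otherwise
  the reflection of \<open>T\<close> in the foot of the perpendicular from the centre would be a second common point.
\<close>

lemma tangent_at_iff:
  fixes X Y P T :: point
  assumes "X \<noteq> Y"
  shows "tangent_at P r X Y T \<longleftrightarrow>
    T \<in> affine hull {X, Y} \<and> (P - T) \<bullet> (Y - X) = 0 \<and> dist P T = r"
proof
  assume tan: "tangent_at P r X Y T"
  then have meet: "Z \<in> sphere P r \<inter> affine hull {X, Y} \<longleftrightarrow> Z = T" for Z
    unfolding tangent_at_def by blast
  have T: "T \<in> affine hull {X, Y}" and r: "dist P T = r"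
    using meet[of T] by simp_all
  have uniq: "Z = T" if "Z \<in> affine hull {X, Y}" "dist P Z = r" for Z
    using meet[of Z] that by simp
  \<comment> \<open>The foot of the perpendicular is \<open>T + q (Y - X)\<close>, and \<open>T'\<close> below is the reflection of \<open>T\<close> in it.\<close>
  define q where "q = ((P - T) \<bullet> (Y - X)) / ((Y - X) \<bullet> (Y - X))"
  have nz: "(Y - X) \<bullet> (Y - X) \<noteq> 0" using assms by simp
  define T' where "T' = T + (2 * q) *\<^sub>R (Y - X)"
  obtain k where k: "T = X + k *\<^sub>R (Y - X)"
    using T by (auto simp: affine_hull_2_alt)
  have "T' = X + (k + 2 * q) *\<^sub>R (Y - X)"
    unfolding T'_def k by (simp add: algebra_simps)
  then have "T' \<in> affine hull {X, Y}"
    by (auto simp: affine_hull_2_alt)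
  moreover have "dist P T' = dist P T"
  proof -
    have expand: "(w - (2 * q) *\<^sub>R z) \<bullet> (w - (2 * q) *\<^sub>R z)
        = w \<bullet> w - 4 * q * (w \<bullet> z) + 4 * q * (q * (z \<bullet> z))" for w z :: point
      by (simp add: inner_diff_left inner_diff_right inner_commute algebra_simps)
    have "P - T' = (P - T) - (2 * q) *\<^sub>R (Y - X)" by (simp add: T'_def)
    then have "(P - T') \<bullet> (P - T') = (P - T) \<bullet> (P - T) - 4 * q * ((P - T) \<bullet> (Y - X))
        + 4 * q * (q * ((Y - X) \<bullet> (Y - X)))"
      by (simp only: expand)
    also have "q * ((Y - X) \<bullet> (Y - X)) = (P - T) \<bullet> (Y - X)"
      using nz by (simp add: q_def)
    finally show ?thesis by (simp add: dist_norm norm_eq)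
  qed
  ultimately have "T' = T" using uniq r by simp
  then have "q = 0" using assms by (simp add: T'_def)
  then show "T \<in> affine hull {X, Y} \<and> (P - T) \<bullet> (Y - X) = 0 \<and> dist P T = r"
    using nz T r by (simp add: q_def)
next
  assume asm: "T \<in> affine hull {X, Y} \<and> (P - T) \<bullet> (Y - X) = 0 \<and> dist P T = r"
  obtain k where k: "T = X + k *\<^sub>R (Y - X)"
    using asm by (auto simp: affine_hull_2_alt)
  have "Z = T" if Z: "Z \<in> affine hull {X, Y}" and dZ: "dist P Z = r" for Z
  proof -
    obtain j where j: "Z = X + j *\<^sub>R (Y - X)"
      using Z by (auto simp: affine_hull_2_alt)
    have ZT: "Z - T = (j - k) *\<^sub>R (Y - X)" unfolding j k by (simp add: algebra_simps)
    have "(P - Z) \<bullet> (P - Z) = (P - T) \<bullet> (P - T) - 2 * ((P - T) \<bullet> (Z - T)) + (Z - T) \<bullet> (Z - T)"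
      by (simp add: inner_diff_left inner_diff_right inner_commute algebra_simps)
    moreover have "(P - T) \<bullet> (Z - T) = 0" unfolding ZT using asm by simp
    moreover have "(P - Z) \<bullet> (P - Z) = (P - T) \<bullet> (P - T)"
      using asm dZ by (simp add: dist_norm flip: power2_norm_eq_inner)
    ultimately show "Z = T" by simp
  qed
  then have "Z \<in> sphere P r \<inter> affine hull {X, Y} \<longleftrightarrow> Z = T" for Z
    using asm by auto
  then show "tangent_at P r X Y T" unfolding tangent_at_def by blast
qed

text \<open>
  By Pythagoras both lengths are determined by the distance of \<open>X\<close> from the centre and the radius.
\<close>

lemma tangent_lengths_eq:
  assumes "X \<noteq> Y" "X \<noteq> Z" "tangent_at P r X Y T" "tangent_at P r X Z U"
  shows "dist X T = dist X U"
proof -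
  have *: "(dist X V)\<^sup>2 = (dist P X)\<^sup>2 - r\<^sup>2" if "X \<noteq> W" "tangent_at P r X W V" for V W
  proof -
    from that have V: "V \<in> affine hull {X, W}" "(P - V) \<bullet> (W - X) = 0" "dist P V = r"
      by (simp_all add: tangent_at_iff)
    obtain k where k: "V = X + k *\<^sub>R (W - X)"
      using V(1) by (auto simp: affine_hull_2_alt)
    have "V - X = k *\<^sub>R (W - X)" by (simp add: k)
    then have "(P - V) \<bullet> (V - X) = 0" using V(2) by simp
    moreover have "(P - X) \<bullet> (P - X) = (P - V) \<bullet> (P - V) + 2 * ((P - V) \<bullet> (V - X)) + (V - X) \<bullet> (V - X)"
      by (simp add: inner_diff_left inner_diff_right inner_commute algebra_simps)
    ultimately show ?thesis using V(3)
      by (simp add: dist_norm power2_norm_eq_inner norm_minus_commute flip: V(3))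
  qed
  show ?thesis using *[OF assms(1,3)] *[OF assms(2,4)]
    by (smt (verit) power2_eq_imp_eq zero_le_dist)
qed

lemma triangle_sides:
  assumes "is_triangle A B C"
  shows "A \<noteq> B" "A \<noteq> C" "B \<noteq> C"
    and "dist B C < dist A B + dist A C"
    and "dist A C < dist A B + dist B C"
    and "dist A B < dist A C + dist B C"
proof -
  have nc: "\<not> collinear {A, B, C}" using assms by (simp add: is_triangle_def)
  then show "A \<noteq> B" "A \<noteq> C" "B \<noteq> C" by (auto simp: insert_commute)
  have "\<not> between (B, C) A" "\<not> between (A, C) B" "\<not> between (A, B) C"
    using nc by (auto simp: collinear_between_cases between_commute)
  then show "dist B C < dist A B + dist A C"
    "dist A C < dist A B + dist B C" "dist A B < dist A C + dist B C"
    using dist_triangle[of B C A] dist_triangle[of A C B] dist_triangle[of A B C]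
    by (auto simp: between dist_commute)
qed

text \<open>
  The two sides at a vertex span the plane. Consequently a point is determined by its inner products
  with them, which is how the centre of an excircle is identified.
\<close>

lemma triangle_dual_zero:
  fixes w :: point
  assumes "is_triangle A B C" "w \<bullet> (B - A) = 0" "w \<bullet> (C - A) = 0"
  shows "w = 0"
proof (rule ccontr)
  assume "w \<noteq> 0"
  define u v where "u = B - A" and "v = C - A"
  have 1: "w$1 * u$1 + w$2 * u$2 = 0" and 2: "w$1 * v$1 + w$2 * v$2 = 0"
    using assms(2,3) by (auto simp: u_def v_def inner_vec_def UNIV_2)
  have "w$1 * (u$1 * v$2 - u$2 * v$1) = 0" "w$2 * (u$1 * v$2 - u$2 * v$1) = 0"
    using 1 2 by algebra+
  moreover have "w$1 \<noteq> 0 \<or> w$2 \<noteq> 0" using \<open>w \<noteq> 0\<close> by (auto simp: vec_eq_iff forall_2)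
  ultimately have d: "u$1 * v$2 = u$2 * v$1" by auto
  \<comment> \<open>A vanishing determinant is the equality case of the Cauchy-Schwarz inequality.\<close>
  have "(u \<bullet> v)\<^sup>2 = (u \<bullet> u) * (v \<bullet> v)"
    using d by (simp add: inner_vec_def UNIV_2) algebra
  then have "\<bar>u \<bullet> v\<bar> = norm u * norm v"
    by (metis norm_eq_sqrt_inner real_sqrt_abs real_sqrt_mult)
  then have "collinear {0, u, v}" by (simp add: norm_cauchy_schwarz_equal)
  then have "collinear {B, A, C}"
    unfolding u_def v_def by (subst collinear_3[of B A C]) (simp_all add: NO_MATCH_def)
  then have "collinear {A, B, C}" by (simp add: insert_commute)
  then show False using assms(1) by (simp add: is_triangle_def)
qed

text \<open>
  A point of the line outside the segment lies beyond \<open>B\<close> or beyond \<open>A\<close>. Only the first position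
  can occur for a point of tangency of the excircle opposite \<open>A\<close>, so the parameter is recorded there alone.
\<close>

lemma line_point_outside_segment:
  fixes A B T :: point
  assumes "A \<noteq> B" "T \<in> affine hull {A, B}" "T \<notin> closed_segment A B"
  shows "(\<exists>k. T = A + k *\<^sub>R (B - A) \<and> dist A T = k * dist A B \<and> dist A T = dist A B + dist B T)
     \<or> dist B T = dist A B + dist A T"
proof -
  obtain k where k: "T = A + k *\<^sub>R (B - A)"
    using assms(2) by (auto simp: affine_hull_2_alt)
  have dA: "dist A T = \<bar>k\<bar> * dist A B"
    by (simp add: k dist_norm norm_minus_commute)
  have "B - T = (1 - k) *\<^sub>R (B - A)" by (simp add: k algebra_simps)
  then have dB: "dist B T = \<bar>1 - k\<bar> * dist A B"
    by (simp add: dist_norm norm_minus_commute)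
  have "\<not> (0 \<le> k \<and> k \<le> 1)"
    using assms(3) by (force simp: k in_segment algebra_simps)
  then consider "k < 0" | "k > 1" by linarith
  then show ?thesis
  proof cases
    case 1 then show ?thesis using dA dB by (simp add: algebra_simps)
  next
    case 2
    then have "dist A T = k * dist A B" "dist A T = dist A B + dist B T"
      using dA dB by (simp_all add: left_diff_distrib)
    then show ?thesis using k by blast
  qed
qed

section \<open>Excircles of arbitrary triangles\<close>

text \<open>
  Let \<open>T\<close>, \<open>U\<close>, \<open>V\<close> be the points of tangency on \<open>BC\<close>, \<open>AB\<close>, \<open>AC\<close>. Tangent segments from a common
  vertex agree, so if \<open>U\<close> and \<open>V\<close> lie beyond \<open>B\<close> and \<open>C\<close>, twice the length \<open>AU = AV\<close> is
  \<open>AB + BT + AC + CT\<close>, the whole perimeter. This makes the tangent length \<open>s\<close>; the two inner products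
  and the power of \<open>A\<close> follow.
\<close>

lemma excircle_tangent_length:
  assumes tri: "is_triangle A B C" and exc: "is_excircle A B C P r"
  defines "s \<equiv> (dist B C + dist A C + dist A B) / 2"
  shows "(P - A) \<bullet> (B - A) = s * dist A B" "(P - A) \<bullet> (C - A) = s * dist A C"
    and "r\<^sup>2 = (dist P A)\<^sup>2 - s\<^sup>2"
proof -
  note ne = triangle_sides(1-3)[OF tri]
  obtain T U V where r: "r > 0"
    and T: "T \<in> closed_segment B C" "tangent_at P r B C T"
    and U: "U \<notin> closed_segment A B" "tangent_at P r A B U"
    and V: "V \<notin> closed_segment A C" "tangent_at P r A C V"
    using exc by (auto simp: is_excircle_def)
  have swap: "tangent_at P r X Y Z \<longleftrightarrow> tangent_at P r Y X Z" for X Y Z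
    by (simp add: tangent_at_def insert_commute)
  have AU: "dist A U = dist A V" using tangent_lengths_eq U V ne by blast
  have BU: "dist B U = dist B T"
    using tangent_lengths_eq[of B A C P r U T] U T ne swap by auto
  have CV: "dist C V = dist C T"
    using tangent_lengths_eq[of C A B P r V T] V T ne swap by auto
  have BC: "dist B C = dist B T + dist C T"
    using T(1) by (simp add: between_mem_segment[symmetric] between dist_commute)
  have U': "U \<in> affine hull {A, B}" "(P - U) \<bullet> (B - A) = 0" "dist P U = r"
    and V': "V \<in> affine hull {A, C}" "(P - V) \<bullet> (C - A) = 0"
    using U V ne by (auto simp: tangent_at_iff)
  note tri_ineq = triangle_sides(4-6)[OF tri]
  note lU = line_point_outside_segment[OF ne(1) U'(1) U(1)]
  note lV = line_point_outside_segment[OF ne(2) V'(1) V(1)]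
  \<comment> \<open>A point of tangency beyond \<open>A\<close> would contradict the strict triangle inequality.\<close>
  have nU: "dist B U \<noteq> dist A B + dist A U" and nV: "dist C V \<noteq> dist A C + dist A V"
    using lU lV AU BU CV BC tri_ineq zero_le_dist[of B T] zero_le_dist[of C T] zero_le_dist[of A U]
    by (smt (verit))+
  obtain k where k: "U = A + k *\<^sub>R (B - A)" "dist A U = k * dist A B" "dist A U = dist A B + dist B U"
    using lU nU by blast
  obtain j where j: "V = A + j *\<^sub>R (C - A)" "dist A V = j * dist A C" "dist A V = dist A C + dist C V"
    using lV nV by blast
  have s: "dist A U = s" "dist A V = s"
    using k(3) j(3) AU BU CV BC by (simp_all add: s_def)
  show "(P - A) \<bullet> (B - A) = s * dist A B"
  proof -
    have "(P - A) \<bullet> (B - A) = (P - U) \<bullet> (B - A) + k * ((B - A) \<bullet> (B - A))"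
      by (simp add: k(1) inner_diff_left inner_diff_right inner_add_left inner_commute algebra_simps)
    also have "(B - A) \<bullet> (B - A) = dist A B * dist A B"
      by (simp add: dist_norm norm_minus_commute power2_norm_eq_inner[symmetric] power2_eq_square[symmetric])
    finally show ?thesis using U'(2) k(2) s(1) by simp
  qed
  show "(P - A) \<bullet> (C - A) = s * dist A C"
  proof -
    have "(P - A) \<bullet> (C - A) = (P - V) \<bullet> (C - A) + j * ((C - A) \<bullet> (C - A))"
      by (simp add: j(1) inner_diff_left inner_diff_right inner_add_left inner_commute algebra_simps)
    also have "(C - A) \<bullet> (C - A) = dist A C * dist A C"
      by (simp add: dist_norm norm_minus_commute power2_norm_eq_inner[symmetric] power2_eq_square[symmetric])
    finally show ?thesis using V'(2) j(2) s(2) by simp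
  qed
  have "(P - U) \<bullet> (U - A) = 0" using U'(2) by (simp add: k(1))
  moreover have "(P - A) \<bullet> (P - A) = (P - U) \<bullet> (P - U) + 2 * ((P - U) \<bullet> (U - A)) + (U - A) \<bullet> (U - A)"
    by (simp add: inner_diff_left inner_diff_right inner_commute algebra_simps)
  ultimately have "(dist P A)\<^sup>2 = (dist P U)\<^sup>2 + (dist A U)\<^sup>2"
    by (simp add: dist_norm power2_norm_eq_inner norm_minus_commute[of A U])
  then show "r\<^sup>2 = (dist P A)\<^sup>2 - s\<^sup>2" using U'(3) s by simp
qed

text \<open>
  With the vertex \<open>A\<close> as origin and \<open>u\<close>, \<open>v\<close> the vectors to \<open>B\<close>, \<open>C\<close>, the excentre is
  \<open>p = (b u + c v) / (b + c - a)\<close>. The inner products \<open>u \<bullet> u\<close>, \<open>u \<bullet> v\<close>, \<open>v \<bullet> v\<close> are known from the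
  side lengths, so every tangency condition becomes an identity in \<open>a\<close>, \<open>b\<close>, \<open>c\<close>. The open disc misses
  the triangle because the line \<open>BC\<close> separates them.
\<close>

lemma excircle_exists:
  assumes tri: "is_triangle A B C"
  defines "a \<equiv> dist B C" and "b \<equiv> dist A C" and "c \<equiv> dist A B"
  defines "s \<equiv> (a + b + c) / 2"
  defines "r \<equiv> sqrt (s * (s - b) * (s - c) / (s - a))"
  shows "\<exists>P. is_excircle A B C P r"
proof -
  note ne = triangle_sides(1-3)[OF tri]
  have pos: "a > 0" "b > 0" "c > 0" using ne by (auto simp: a_def b_def c_def)
  have sp: "s - a > 0" "s - b > 0" "s - c > 0" "s > 0"
    using triangle_sides(4-6)[OF tri] pos by (auto simp: s_def a_def b_def c_def)
  have rsq: "r\<^sup>2 * (s - a) = s * (s - b) * (s - c)" and rpos: "r > 0"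
    using sp by (auto simp: r_def)
  define u v where "u = B - A" and "v = C - A"
  define p where "p = (1 / (2 * (s - a))) *\<^sub>R (b *\<^sub>R u + c *\<^sub>R v)"
  have uu: "u \<bullet> u = c * c" and vv: "v \<bullet> v = b * b"
    by (simp_all add: u_def v_def c_def b_def dist_norm norm_minus_commute
        power2_norm_eq_inner[symmetric] power2_eq_square[symmetric])
  have "(v - u) \<bullet> (v - u) = a * a"
    by (simp add: u_def v_def a_def dist_norm norm_minus_commute
        power2_norm_eq_inner[symmetric] power2_eq_square[symmetric])
  then have uv: "u \<bullet> v = (b * b + c * c - a * a) / 2"
    using uu vv by (simp add: inner_diff_left inner_diff_right inner_commute)
  have pu: "p \<bullet> u = s * c"
  proof -
    have "p \<bullet> u = (b * (u \<bullet> u) + c * (u \<bullet> v)) / (2 * (s - a))"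
      by (simp add: p_def inner_add_left inner_commute[of v u])
    also have "b * (u \<bullet> u) + c * (u \<bullet> v) = s * c * (2 * (s - a))"
      by (simp add: uu uv s_def field_simps)
    finally show ?thesis using sp(1) by simp
  qed
  have pv: "p \<bullet> v = s * b"
  proof -
    have "p \<bullet> v = (b * (u \<bullet> v) + c * (v \<bullet> v)) / (2 * (s - a))"
      by (simp add: p_def inner_add_left)
    also have "b * (u \<bullet> v) + c * (v \<bullet> v) = s * b * (2 * (s - a))"
      by (simp add: vv uv s_def field_simps)
    finally show ?thesis using sp(1) by simp
  qed
  have pp: "p \<bullet> p = s\<^sup>2 + r\<^sup>2"
  proof -
    have "p \<bullet> p = (b * (p \<bullet> u) + c * (p \<bullet> v)) / (2 * (s - a))"
      by (subst (2) p_def) (simp add: inner_add_right)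
    then have "(p \<bullet> p) * (s - a) = b * c * s"
      using sp(1) by (simp add: pu pv field_simps)
    also have "\<dots> = (s\<^sup>2 + r\<^sup>2) * (s - a)"
      unfolding distrib_right rsq by (simp add: s_def field_simps power2_eq_square)
    finally show ?thesis using sp(1) by simp
  qed
  define P where "P = A + p"
  \<comment> \<open>The point of tangency on \<open>BC\<close> has distance \<open>s - c\<close> from \<open>B\<close> and \<open>s - b\<close> from \<open>C\<close>.\<close>
  define t where "t = u + ((s - c) / a) *\<^sub>R (v - u)"
  have dist_sq: "dist P Z = r" if "(P - Z) \<bullet> (P - Z) = r\<^sup>2" for Z
    using that rpos by (simp add: dist_norm norm_eq_sqrt_inner)
  have tv: "t \<bullet> u = c * c + ((s - c) / a) * (u \<bullet> v - c * c)"
    by (simp add: t_def inner_add_left inner_diff_left uu inner_commute[of v u])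
  have tw: "t \<bullet> (v - u) = u \<bullet> v - c * c + (s - c) * a"
    using pos(1) \<open>(v - u) \<bullet> (v - u) = a * a\<close>
    by (simp add: t_def inner_add_left uu inner_diff_right[of u])
  have perp: "(p - t) \<bullet> (v - u) = 0"
    by (simp add: inner_diff_left[of p t] tw inner_diff_right[of p] pu pv uv)
      (simp add: s_def field_simps)
  have BC: "tangent_at P r B C (A + t)" and seg: "A + t \<in> closed_segment B C"
  proof -
    have 1: "A + t = B + ((s - c) / a) *\<^sub>R (C - B)"
      by (simp add: t_def u_def v_def)
    have "0 \<le> (s - c) / a" "(s - c) / a \<le> 1" using sp pos by (auto simp: s_def)
    then show "A + t \<in> closed_segment B C"
      unfolding 1 by (auto simp: in_segment algebra_simps intro!: exI[of _ "(s - c) / a"])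
    have tu: "(t - u) \<bullet> (t - u) = (s - c)\<^sup>2"
      using pos(1) \<open>(v - u) \<bullet> (v - u) = a * a\<close> by (simp add: t_def power2_eq_square)
    have "(p - t) \<bullet> (t - u) = 0" using perp by (simp add: t_def)
    then have "(p - t) \<bullet> (p - t) = (p - u) \<bullet> (p - u) - (t - u) \<bullet> (t - u)"
      by (simp add: inner_diff_left inner_diff_right inner_commute algebra_simps)
    also have "\<dots> = r\<^sup>2"
      unfolding tu by (simp add: inner_diff_left inner_diff_right inner_commute[of u p] pp pu uu power2_eq_square algebra_simps)
    finally have "(p - t) \<bullet> (p - t) = r\<^sup>2" .
    then have "dist P (A + t) = r" by (intro dist_sq) (simp add: P_def)
    moreover have "A + t \<in> affine hull {B, C}" by (auto simp: affine_hull_2_alt 1)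
    moreover have "(P - (A + t)) \<bullet> (C - B) = 0" using perp by (simp add: P_def u_def v_def)
    ultimately show "tangent_at P r B C (A + t)" using ne by (simp add: tangent_at_iff)
  qed
  have side: "\<exists>T. T \<notin> closed_segment A X \<and> tangent_at P r A X T"
    if "A \<noteq> X" "p \<bullet> (X - A) = s * dist A X" "s > dist A X" for X
  proof -
    define T where "T = A + (s / dist A X) *\<^sub>R (X - A)"
    have xx: "(X - A) \<bullet> (X - A) = (dist A X)\<^sup>2"
      by (metis dist_commute dist_norm power2_norm_eq_inner)
    have "dist A T = s" using that sp by (simp add: T_def dist_norm norm_minus_commute)
    have "T \<notin> closed_segment A X"
      using \<open>dist A T = s\<close> that(3) dist_in_closed_segment[of T A X] by (auto simp: dist_commute)
    have PT: "P - T = p - (s / dist A X) *\<^sub>R (X - A)" by (simp add: P_def T_def)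
    have perp: "(P - T) \<bullet> (X - A) = 0"
      unfolding PT using that by (simp add: inner_diff_left[of p] xx power2_eq_square)
    have "(P - T) \<bullet> (P - T) = (P - T) \<bullet> p"
      using perp by (subst (2) PT) (simp add: inner_diff_right)
    also have "\<dots> = p \<bullet> p - s / dist A X * (p \<bullet> (X - A))"
      unfolding PT by (simp add: inner_diff_left[of p] inner_commute[of p "X - A"])
    also have "\<dots> = r\<^sup>2"
      using that by (simp add: pp power2_eq_square)
    finally have "dist P T = r" by (rule dist_sq)
    moreover have "T \<in> affine hull {A, X}" by (auto simp: affine_hull_2_alt T_def)
    ultimately show ?thesis using perp that \<open>T \<notin> closed_segment A X\<close> by (auto simp: tangent_at_iff)
  qed
  have disj: "ball P r \<inter> convex hull {A, B, C} = {}"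
  proof -
    \<comment> \<open>The closed half-plane of the line \<open>BC\<close> that does not contain the centre.\<close>
    define H where "H = {x. (p - t) \<bullet> x \<le> (p - t) \<bullet> (A + t)}"
    have uH: "(p - t) \<bullet> u = (p - t) \<bullet> t" using perp by (simp add: t_def inner_add_right)
    have vH: "(p - t) \<bullet> v = (p - t) \<bullet> t" using perp uH by (simp add: inner_diff_right)
    have "(p - t) \<bullet> u = s * c - c * c - ((s - c) / a) * (u \<bullet> v - c * c)"
      by (simp add: inner_diff_left pu tv)
    also have "\<dots> = (s - c) * s * (a + c - b) / a"
      using pos(1) by (simp add: uv s_def field_simps)
    also have "\<dots> > 0" using sp pos by (simp add: s_def)
    finally have pos_t: "(p - t) \<bullet> t > 0" using uH by simp
    have "A \<in> H" using pos_t by (simp add: H_def inner_add_right)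
    moreover have "B \<in> H" "C \<in> H"
      using uH vH by (simp_all add: H_def u_def v_def inner_add_right inner_diff_right)
    ultimately have sub: "convex hull {A, B, C} \<subseteq> H"
      by (intro hull_minimal) (auto simp: H_def convex_halfspace_le)
    have "r \<le> dist P x" if "x \<in> H" for x
    proof -
      have Pt: "(p - t) \<bullet> (p - t) = r\<^sup>2"
        using BC ne by (auto simp: tangent_at_iff P_def dist_norm norm_eq_sqrt_inner)
      have x: "(p - t) \<bullet> (x - (A + t)) \<le> 0" using that by (simp add: H_def inner_diff_right)
      have "P - x = (p - t) - (x - (A + t))" by (simp add: P_def)
      then have "(P - x) \<bullet> (P - x) = r\<^sup>2 - 2 * ((p - t) \<bullet> (x - (A + t))) + (x - (A + t)) \<bullet> (x - (A + t))"
        using Pt by (simp add: inner_diff_left inner_diff_right inner_commute algebra_simps)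
      then have "r\<^sup>2 \<le> (P - x) \<bullet> (P - x)" using x by (smt (verit) inner_ge_zero)
      then show ?thesis using rpos by (simp add: dist_norm norm_eq_sqrt_inner real_le_rsqrt)
    qed
    then show ?thesis using sub by fastforce
  qed
  have "\<exists>T. T \<notin> closed_segment A B \<and> tangent_at P r A B T"
    using side[of B] ne pu sp by (simp add: u_def c_def)
  moreover have "\<exists>T. T \<notin> closed_segment A C \<and> tangent_at P r A C T"
    using side[of C] ne pv sp by (simp add: v_def b_def)
  ultimately have "is_excircle A B C P r"
    unfolding is_excircle_def using rpos disj BC seg by blast
  then show ?thesis ..
qed

text \<open>
  This is \<open>E / (s - a)\<close> with the area \<open>E\<close> replaced by Heron's formula.
\<close>

lemma exradius_eq:
  assumes tri: "is_triangle A B C"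
  defines "a \<equiv> dist B C" and "b \<equiv> dist A C" and "c \<equiv> dist A B"
  defines "s \<equiv> (a + b + c) / 2"
  shows "exradius A B C = sqrt (s * (s - b) * (s - c) / (s - a))"
proof -
  have uniq: "r = r'" if "is_excircle A B C P r" "is_excircle A B C P' r'" for P P' r r'
  proof -
    note 1 = excircle_tangent_length[OF tri that(1)]
    note 2 = excircle_tangent_length[OF tri that(2)]
    have "(P - P') \<bullet> (B - A) = 0" "(P - P') \<bullet> (C - A) = 0"
      using 1(1,2) 2(1,2) by (simp_all add: inner_diff_left)
    then have "P = P'" using triangle_dual_zero[OF tri, of "P - P'"] by simp
    then have "r\<^sup>2 = r'\<^sup>2" using 1(3) 2(3) by simp
    moreover have "r > 0" "r' > 0" using that by (auto simp: is_excircle_def)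
    ultimately show ?thesis by simp
  qed
  obtain P where P: "is_excircle A B C P (sqrt (s * (s - b) * (s - c) / (s - a)))"
    using excircle_exists[OF tri] unfolding a_def b_def c_def s_def by (rule exE)
  show ?thesis
    unfolding exradius_def
  proof (rule the_equality)
    show "\<exists>P. is_excircle A B C P (sqrt (s * (s - b) * (s - c) / (s - a)))"
      by (rule exI) (rule P)
    show "r = sqrt (s * (s - b) * (s - c) / (s - a))" if "\<exists>P. is_excircle A B C P r" for r
      using that by (elim exE) (rule uniq[OF _ P])
  qed
qed

section \<open>Isosceles triangles\<close>

text \<open>
  Here \<open>s = b + c\<close>, and Heron's formula and the exradii lose their roots because
  \<open>(b + c) (b - c)\<close> is the square of the height.
\<close>

lemma isosceles_measures:
  assumes tri: "is_triangle A B C"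
    and b: "dist A B = b" "dist A C = b" and c: "dist B C = 2 * c"
    and h: "h \<ge> 0" "b\<^sup>2 = c\<^sup>2 + h\<^sup>2"
  shows "0 < c" "c < b" "0 < h"
    and "area A B C = c * h"
    and "exradius A B C = c * h / (b - c)"
    and "exradius B C A = h" and "exradius C A B = h"
proof -
  show cb: "0 < c" "c < b"
    using triangle_sides(3,4)[OF tri] b c zero_less_dist_iff[of B C] by auto
  have hsq: "h\<^sup>2 = (b - c) * (b + c)" using h(2) by (simp add: power2_eq_square algebra_simps)
  then have "h\<^sup>2 > 0" using cb by simp
  then show "0 < h" using h(1) by (cases "h = 0") auto
  \<comment> \<open>The semi-perimeter, as it arises from each of the three vertices.\<close>
  have half: "(2 * c + b + b) / 2 = b + c" "(b + b + 2 * c) / 2 = b + c" "(b + 2 * c + b) / 2 = b + c"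
    by simp_all
  have root: "sqrt x = y" if "x = y\<^sup>2" "y \<ge> 0" for x y :: real using that by simp
  have "area A B C = sqrt ((b + c) * (b - c) * (c * c))"
  proof -
    have "convex hull {A, B, C} \<in> sets lborel"
      by (simp add: borel_compact finite_imp_compact_convex_hull)
    then have "area A B C = measure lborel (convex hull {A, B, C})"
      by (simp add: area_def)
    also have "\<dots> = sqrt ((b + c) * (b - c) * (c * c))"
      unfolding heron b c half by (simp add: mult.assoc)
    finally show ?thesis .
  qed
  also have "\<dots> = c * h"
  proof (rule root)
    show "(b + c) * (b - c) * (c * c) = (c * h)\<^sup>2"
      unfolding power_mult_distrib hsq by (simp add: power2_eq_square)
  qed (use cb h in simp)
  finally show "area A B C = c * h" .
  have "exradius A B C = sqrt ((b + c) * c * c / (b - c))"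
    unfolding exradius_eq[OF tri] b c half by (simp add: mult.assoc)
  also have "\<dots> = c * h / (b - c)"
  proof (rule root)
    show "(b + c) * c * c / (b - c) = (c * h / (b - c))\<^sup>2"
      unfolding power_divide power_mult_distrib hsq using cb by (simp add: power2_eq_square)
  qed (use cb h in simp)
  finally show "exradius A B C = c * h / (b - c)" .
  have rot: "is_triangle B C A" "is_triangle C A B"
    using tri by (simp_all add: is_triangle_def insert_commute)
  have d: "dist C A = b" "dist B A = b" "dist C B = 2 * c" using b c by (simp_all add: dist_commute)
  have "exradius B C A = sqrt ((b + c) * c * (b - c) / c)"
    unfolding exradius_eq[OF rot(1)] b c d half by (simp add: ac_simps)
  also have "\<dots> = h" using cb h by (intro root) (simp_all add: hsq)
  finally show "exradius B C A = h" .
  have "exradius C A B = sqrt ((b + c) * (b - c) * c / c)"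
    unfolding exradius_eq[OF rot(2)] b c d half by (simp add: ac_simps)
  also have "\<dots> = h" using cb h by (intro root) (simp_all add: hsq)
  finally show "exradius C A B = h" .
qed

lemma isosceles_exists:
  assumes "0 < c" "c < b"
  obtains A B C where "is_triangle A B C" "dist A B = b" "dist A C = b" "dist B C = 2 * c"
proof
  define h where "h = sqrt (b\<^sup>2 - c\<^sup>2)"
  have "c\<^sup>2 < b\<^sup>2" using assms by (simp add: power_strict_mono)
  then have h: "h > 0" "h\<^sup>2 = b\<^sup>2 - c\<^sup>2" by (simp_all add: h_def)
  define A B C :: point where "A = vector [0, h]" and "B = vector [- c, 0]" and "C = vector [c, 0]"
  show d: "dist A B = b" "dist A C = b" "dist B C = 2 * c"
    using assms h
    by (simp_all add: A_def B_def C_def dist_vec_def L2_set_def UNIV_2 dist_real_def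
        real_sqrt_mult)
  show "is_triangle A B C"
    using d assms unfolding is_triangle_def collinear_between_cases between
    by (simp add: dist_commute)
qed

section \<open>The underlying Diophantine problem\<close>

text \<open>
  The quotient \<open>p / q\<close> of \<open>h\<close> and \<open>b - c\<close> in lowest terms parametrizes the Pythagorean triple, and the
  two families correspond to its two possible parities. The divisibility hypothesis says that the
  exradius at the apex is an integer.
\<close>

lemma isosceles_integral_parametrization:
  fixes b c h :: nat
  assumes pos: "0 < c" "0 < h" and pyth: "b\<^sup>2 = c\<^sup>2 + h\<^sup>2" and dvd: "(b - c) dvd c * h"
  shows "(\<exists>K m n. 0 < K \<and> admissible m n \<and> b = K * n * (m\<^sup>2 + n\<^sup>2) \<and> c = K * n * (m\<^sup>2 - n\<^sup>2)) \<or>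
    (\<exists>L m n. 0 < L \<and> admissible m n \<and> b = L * (m - n) * (m\<^sup>2 + n\<^sup>2) \<and> c = 2 * L * (m - n) * m * n)"
proof -
  have "c\<^sup>2 < b\<^sup>2" using pyth pos by simp
  then have "c < b" by (rule power_less_imp_less_base) simp
  define d where "d = b - c"
  have b: "b = c + d" and d: "0 < d" using \<open>c < b\<close> by (simp_all add: d_def)
  have hsq: "h * h = d * (2 * c + d)" using pyth by (simp add: b power2_eq_square algebra_simps)
  define g where "g = gcd h d"
  have "g \<noteq> 0" using d by (simp add: g_def)
  then obtain p q where hp: "h = p * g" and dq: "d = q * g" and cop: "coprime p q"
    unfolding g_def using gcd_coprime_exists[of h d] by auto
  have q: "0 < q" using d dq by auto
  have eq: "p * p * g = q * (2 * c + d)" using hsq \<open>g \<noteq> 0\<close> by (simp add: hp dq)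
  then have "q dvd (p * p) * g" by simp
  then have "q dvd g" using cop by (simp add: coprime_dvd_mult_right_iff coprime_commute)
  then obtain f where gf: "g = q * f" by blast
  have f: "0 < f" using gf \<open>g \<noteq> 0\<close> by auto
  have sum: "2 * c + q * q * f = p * p * f" using eq q by (simp add: gf dq)
  have bq: "b = c + q * q * f" by (simp add: b dq gf)
  have "q dvd c"
  proof -
    have "q * (q * f) dvd c * p * (q * f)" using dvd by (simp add: d_def[symmetric] hp dq gf ac_simps)
    then have "q dvd c * p" using q f by simp
    then show ?thesis using cop by (simp add: coprime_dvd_mult_left_iff coprime_commute)
  qed
  have "q * q * f < p * p * f" using sum pos by linarith
  then have "q\<^sup>2 < p\<^sup>2" by (simp add: power2_eq_square)
  then have "q < p" by (rule power_less_imp_less_base) simp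
  show ?thesis
  proof (cases "even p \<longleftrightarrow> odd q")
    case True
    then have adm: "admissible p q" using q \<open>q < p\<close> cop by (simp add: admissible_def)
    have "even (q * q * f) \<longleftrightarrow> even (p * p * f)" by (metis sum even_add dvd_triv_left)
    then have "even f" using True by auto
    then obtain k where k: "f = 2 * k" by blast
    have ck: "c + q * q * k = p * p * k" using sum by (simp add: k)
    then have "q dvd p * p * k" using \<open>q dvd c\<close> by (metis dvd_add dvd_triv_left mult.assoc)
    then have "q dvd k" using cop by (simp add: coprime_dvd_mult_right_iff coprime_commute)
    then obtain K where K: "k = q * K" by blast
    have "0 < K" using f k K by auto
    moreover have "c = K * q * (p\<^sup>2 - q\<^sup>2)"
      using ck unfolding K power2_eq_square diff_mult_distrib2 by (simp add: ac_simps)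
    moreover have "b = K * q * (p\<^sup>2 + q\<^sup>2)"
      using ck bq by (simp add: k K power2_eq_square algebra_simps)
    ultimately show ?thesis using adm by blast
  next
    case False
    then have odd: "odd p" "odd q" using cop by (auto simp: coprime_def)
    \<comment> \<open>The substitution \<open>p = m + n\<close>, \<open>q = m - n\<close> turns \<open>p\<^sup>2 + q\<^sup>2\<close> into \<open>2 (m\<^sup>2 + n\<^sup>2)\<close>, which absorbs
      the factor \<open>2\<close> that \<open>f\<close> need not provide when \<open>p\<close> and \<open>q\<close> are odd.\<close>
    define n where "n = (p - q) div 2"
    have p: "p = 2 * n + q" using odd \<open>q < p\<close> by (simp add: n_def)
    define m where "m = n + q"
    have n: "0 < n" using p \<open>q < p\<close> by simp
    have c: "c = 2 * f * m * n" using sum by (simp add: p m_def algebra_simps)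
    have qn: "coprime q (2 * n)"
      using cop unfolding p by (metis coprime_commute coprime_iff_gcd_eq_1 gcd_add1)
    then have qn': "coprime q n" by simp
    then have qm: "coprime q m" and nm: "coprime m n" unfolding m_def
      by (metis coprime_commute coprime_iff_gcd_eq_1 gcd_add1 add.commute)+
    have adm: "admissible m n" using n q nm odd by (auto simp: admissible_def m_def)
    have "q dvd (2 * n * m) * f" using \<open>q dvd c\<close> by (simp add: c ac_simps)
    moreover have "coprime q (2 * n * m)" using qn qm by simp
    ultimately have "q dvd f" by (simp add: coprime_dvd_mult_right_iff)
    then obtain L where L: "f = q * L" by blast
    have "0 < L" using f L by auto
    moreover have "m - n = q" by (simp add: m_def)
    moreover have "b = L * q * (m\<^sup>2 + n\<^sup>2)"
      using bq by (simp add: c L m_def power2_eq_square algebra_simps)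
    moreover have "c = 2 * L * q * m * n" by (simp add: c L)
    ultimately show ?thesis using adm by metis
  qed
qed

section \<open>The two families\<close>

lemma family1_measures:
  assumes K: "0 < K" and adm: "admissible m n" and fam: "(A, B, C) \<in> family1 K m n"
  shows "area A B C = (real K * real n * ((real m)\<^sup>2 - (real n)\<^sup>2)) * (2 * real K * real m * (real n)\<^sup>2)"
    and "exradius A B C = real K * real m * ((real m)\<^sup>2 - (real n)\<^sup>2)"
    and "exradius B C A = 2 * real K * real m * (real n)\<^sup>2"
    and "exradius C A B = 2 * real K * real m * (real n)\<^sup>2"
proof -
  define b c h where "b = real K * real n * ((real m)\<^sup>2 + (real n)\<^sup>2)"
    and "c = real K * real n * ((real m)\<^sup>2 - (real n)\<^sup>2)"
    and "h = 2 * real K * real m * (real n)\<^sup>2"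
  have tri: "is_triangle A B C" and d: "dist A B = b" "dist A C = b" "dist B C = 2 * c"
    using fam by (simp_all add: family1_def b_def c_def)
  have "h \<ge> 0" "b\<^sup>2 = c\<^sup>2 + h\<^sup>2"
    by (simp_all add: b_def c_def h_def power2_eq_square algebra_simps)
  note M = isosceles_measures[OF tri d this]
  have n: "real n > 0" "real K > 0" using adm K by (simp_all add: admissible_def)
  have "b - c = 2 * real K * (real n * (real n)\<^sup>2)" by (simp add: b_def c_def algebra_simps)
  then have "c * h / (b - c) = real K * real m * ((real m)\<^sup>2 - (real n)\<^sup>2)"
    using n by (simp add: c_def h_def)
  then show "exradius A B C = real K * real m * ((real m)\<^sup>2 - (real n)\<^sup>2)" using M(5) by simp
  show "area A B C = (real K * real n * ((real m)\<^sup>2 - (real n)\<^sup>2)) * (2 * real K * real m * (real n)\<^sup>2)"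
    "exradius B C A = 2 * real K * real m * (real n)\<^sup>2"
    "exradius C A B = 2 * real K * real m * (real n)\<^sup>2"
    using M by (simp_all add: c_def h_def)
qed

lemma family2_measures:
  assumes L: "0 < L" and adm: "admissible m n" and fam: "(A, B, C) \<in> family2 L m n"
  shows "area A B C = (2 * real L * (real m - real n) * real m * real n)
      * (real L * (real m + real n) * (real m - real n)\<^sup>2)"
    and "exradius A B C = 2 * real L * real m * real n * (real m + real n)"
    and "exradius B C A = real L * (real m + real n) * (real m - real n)\<^sup>2"
    and "exradius C A B = real L * (real m + real n) * (real m - real n)\<^sup>2"
proof -
  define b c h where "b = real L * (real m - real n) * ((real m)\<^sup>2 + (real n)\<^sup>2)"
    and "c = 2 * real L * (real m - real n) * real m * real n"
    and "h = real L * (real m + real n) * (real m - real n)\<^sup>2"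
  have tri: "is_triangle A B C" and d: "dist A B = b" "dist A C = b" "dist B C = 2 * c"
    using fam by (simp_all add: family2_def b_def c_def)
  have "h \<ge> 0" by (simp add: h_def)
  have "b\<^sup>2 = c\<^sup>2 + h\<^sup>2"
    by (simp add: b_def c_def h_def power2_eq_square algebra_simps)
  note M = isosceles_measures[OF tri d \<open>h \<ge> 0\<close> this]
  have n: "real m - real n > 0" "real L > 0" using adm L by (simp_all add: admissible_def)
  have "b - c = real L * ((real m - real n) * (real m - real n)\<^sup>2)"
    by (simp add: b_def c_def power2_eq_square algebra_simps)
  then have "c * h / (b - c) = 2 * real L * real m * real n * (real m + real n)"
    using n by (simp add: c_def h_def)
  then show "exradius A B C = 2 * real L * real m * real n * (real m + real n)" using M(5) by simp
  show "area A B C = (2 * real L * (real m - real n) * real m * real n)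
      * (real L * (real m + real n) * (real m - real n)\<^sup>2)"
    "exradius B C A = real L * (real m + real n) * (real m - real n)\<^sup>2"
    "exradius C A B = real L * (real m + real n) * (real m - real n)\<^sup>2"
    using M by (simp_all add: c_def h_def)
qed

text \<open>
  Numbers of different parities have an odd sum of squares. In both families an equilateral triangle
  would make this sum twice an integer.
\<close>

lemma admissible_sum_squares_neq_double:
  assumes "admissible m n"
  shows "(real m)\<^sup>2 + (real n)\<^sup>2 \<noteq> 2 * real_of_int x"
proof
  assume "(real m)\<^sup>2 + (real n)\<^sup>2 = 2 * real_of_int x"
  then have "real_of_int ((int m)\<^sup>2 + (int n)\<^sup>2) = real_of_int (2 * x)" by simp
  then have "(int m)\<^sup>2 + (int n)\<^sup>2 = 2 * x" by (simp only: of_int_eq_iff)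
  then have "even ((int m)\<^sup>2 + (int n)\<^sup>2)" by simp
  then show False using assms by (auto simp: admissible_def)
qed

lemma F1_subset_S: "F1 \<subseteq> S"
proof
  fix t assume "t \<in> F1"
  then obtain A B C K m n where t: "t = (A, B, C)" and K: "0 < K" and adm: "admissible m n"
    and fam: "(A, B, C) \<in> family1 K m n"
    unfolding F1_def by (cases t) auto
  have "real K * real n > 0" using K adm by (simp add: admissible_def)
  moreover have "(real m)\<^sup>2 + (real n)\<^sup>2 \<noteq> 2 * ((real m)\<^sup>2 - (real n)\<^sup>2)"
    using admissible_sum_squares_neq_double[OF adm, of "(int m)\<^sup>2 - (int n)\<^sup>2"] by simp
  ultimately have "real K * real n * ((real m)\<^sup>2 + (real n)\<^sup>2)
      \<noteq> real K * real n * (2 * ((real m)\<^sup>2 - (real n)\<^sup>2))"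
    by (metis mult_left_cancel less_irrefl)
  then have "dist A C \<noteq> dist B C" using fam by (simp add: family1_def mult.left_commute mult.assoc)
  then show "t \<in> S"
    using fam family1_measures[OF K adm fam] by (simp add: t S_def family1_def)
qed

lemma F2_subset_S: "F2 \<subseteq> S"
proof
  fix t assume "t \<in> F2"
  then obtain A B C L m n where t: "t = (A, B, C)" and L: "0 < L" and adm: "admissible m n"
    and fam: "(A, B, C) \<in> family2 L m n"
    unfolding F2_def by (cases t) auto
  have "real L * (real m - real n) > 0" using L adm by (simp add: admissible_def)
  moreover have "(real m)\<^sup>2 + (real n)\<^sup>2 \<noteq> 2 * (2 * (real m * real n))"
    using admissible_sum_squares_neq_double[OF adm, of "2 * int m * int n"] by simp
  ultimately have "real L * (real m - real n) * ((real m)\<^sup>2 + (real n)\<^sup>2)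
      \<noteq> real L * (real m - real n) * (2 * (2 * (real m * real n)))"
    by (metis mult_left_cancel less_irrefl)
  then have "dist A C \<noteq> dist B C" using fam by (simp add: family2_def ac_simps)
  then show "t \<in> S"
    using fam family2_measures[OF L adm fam] by (simp add: t S_def family2_def)
qed

text \<open>
  The Diophantine problem needs an integral height and an even base. The height is the exradius at
  \<open>B\<close>, and the base is even because its square is \<open>4 b\<^sup>2 - 4 h\<^sup>2\<close>.
\<close>

lemma S_subset_families: "S \<subseteq> F1 \<union> F2"
proof
  fix t assume "t \<in> S"
  then obtain A B C where t: "t = (A, B, C)" and tri: "is_triangle A B C"
    and iso: "dist A B = dist A C"
    and ints: "dist B C \<in> \<int>" "dist A C \<in> \<int>" "exradius A B C \<in> \<int>" "exradius B C A \<in> \<int>"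
    unfolding S_def by (cases t) auto
  have nat: "\<exists>k. x = real k" if "x \<in> \<int>" "0 \<le> x" for x :: real
    using that by (metis Ints_cases of_int_0_le_iff zero_le_imp_eq_int of_int_of_nat_eq)
  obtain a b where a: "dist B C = real a" and b: "dist A C = real b"
    using nat ints by (metis zero_le_dist)
  have ab: "0 < a" "real a < 2 * real b"
    using triangle_sides(3,4)[OF tri] a b iso by (auto intro: Suc_leI gr0I)
  define y where "y = sqrt ((real b)\<^sup>2 - (real a / 2)\<^sup>2)"
  have "(real a / 2)\<^sup>2 < (real b)\<^sup>2" using ab by (intro power_strict_mono) auto
  then have "0 \<le> (real b)\<^sup>2 - (real a / 2)\<^sup>2" by (simp only: diff_ge_0_iff_ge less_imp_le)
  then have y: "y \<ge> 0" "(real b)\<^sup>2 = (real a / 2)\<^sup>2 + y\<^sup>2"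
    unfolding y_def by (simp_all only: real_sqrt_ge_zero real_sqrt_pow2)
  have "dist A B = real b" "dist B C = 2 * (real a / 2)" using a b iso by simp_all
  note M = isosceles_measures[OF tri this(1) b this(2) y]
  have "y \<in> \<int>" using M(6) ints by simp
  then obtain h where h: "y = real h" using nat y(1) by blast
  have "real (4 * b\<^sup>2) = real (a\<^sup>2 + 4 * h\<^sup>2)" using y(2) by (simp add: h power_divide)
  then have sq: "4 * b\<^sup>2 = a\<^sup>2 + 4 * h\<^sup>2" by (simp only: of_nat_eq_iff)
  then have "even (a\<^sup>2 + 4 * h\<^sup>2)" by (metis dvd_triv_left dvd_mult2 even_numeral)
  then have "even a" by simp
  then obtain c where c: "a = 2 * c" by blast
  have pos: "0 < c" "0 < h" using ab M(3) by (simp_all add: c h)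
  have pyth: "b\<^sup>2 = c\<^sup>2 + h\<^sup>2" using sq by (simp add: c power_mult_distrib)
  have cb: "c < b" using ab by (simp add: c)
  have "exradius A B C \<ge> 0" using M by simp
  then obtain r where r: "exradius A B C = real r" using nat ints by blast
  have "real (c * h) = real ((b - c) * r)"
    using M(5) cb by (simp add: r c h of_nat_diff field_simps)
  then have "(b - c) dvd c * h" by (metis of_nat_eq_iff dvd_triv_left)
  from isosceles_integral_parametrization[OF pos pyth this] show "t \<in> F1 \<union> F2"
  proof (elim disjE exE conjE)
    fix K m n assume H: "0 < K" "admissible m n" "b = K * n * (m\<^sup>2 + n\<^sup>2)" "c = K * n * (m\<^sup>2 - n\<^sup>2)"
    have "n\<^sup>2 \<le> m\<^sup>2" using H(2) by (simp add: admissible_def power_mono)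
    then have "(A, B, C) \<in> family1 K m n"
      using tri iso a b c H(3,4) by (simp add: family1_def of_nat_diff)
    then show ?thesis using H t by (auto simp: F1_def)
  next
    fix L m n assume H: "0 < L" "admissible m n" "b = L * (m - n) * (m\<^sup>2 + n\<^sup>2)" "c = 2 * L * (m - n) * m * n"
    have "n \<le> m" using H(2) by (simp add: admissible_def)
    then have "(A, B, C) \<in> family2 L m n"
      using tri iso a b c H(3,4) by (simp add: family2_def of_nat_diff)
    then show ?thesis using H t by (auto simp: F2_def)
  qed
qed

lemma family1_nonempty:
  assumes "0 < K" "admissible m n"
  shows "family1 K m n \<noteq> {}"
proof -
  have n: "0 < real K * real n" "real n < real m" using assms by (simp_all add: admissible_def)
  then have "(real n)\<^sup>2 < (real m)\<^sup>2" by (intro power_strict_mono) auto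
  then have "0 < real K * real n * ((real m)\<^sup>2 - (real n)\<^sup>2)"
    using n(1) by simp
  moreover have "real K * real n * ((real m)\<^sup>2 - (real n)\<^sup>2) < real K * real n * ((real m)\<^sup>2 + (real n)\<^sup>2)"
    using assms by (intro mult_strict_left_mono n(1)) (simp add: admissible_def)
  ultimately obtain A B C where "is_triangle A B C"
    "dist A B = real K * real n * ((real m)\<^sup>2 + (real n)\<^sup>2)"
    "dist A C = real K * real n * ((real m)\<^sup>2 + (real n)\<^sup>2)"
    "dist B C = 2 * (real K * real n * ((real m)\<^sup>2 - (real n)\<^sup>2))"
    by (rule isosceles_exists)
  then have "(A, B, C) \<in> family1 K m n" by (simp add: family1_def)
  then show ?thesis by blast
qed

lemma family2_nonempty:
  assumes "0 < L" "admissible m n"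
  shows "family2 L m n \<noteq> {}"
proof -
  have n: "0 < real L * (real m - real n)" "0 < real m" "0 < real n" "real m \<noteq> real n"
    using assms by (auto simp: admissible_def)
  have "0 < real L * (real m - real n) * (2 * (real m * real n))"
    using n by simp
  moreover have "real L * (real m - real n) * (2 * (real m * real n))
      < real L * (real m - real n) * ((real m)\<^sup>2 + (real n)\<^sup>2)"
  proof (intro mult_strict_left_mono n(1))
    have "0 < (real m - real n)\<^sup>2" using n(4) by simp
    then show "2 * (real m * real n) < (real m)\<^sup>2 + (real n)\<^sup>2"
      by (simp add: power2_eq_square algebra_simps)
  qed
  ultimately obtain A B C where "is_triangle A B C"
    "dist A B = real L * (real m - real n) * ((real m)\<^sup>2 + (real n)\<^sup>2)"
    "dist A C = real L * (real m - real n) * ((real m)\<^sup>2 + (real n)\<^sup>2)"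
    "dist B C = 2 * (real L * (real m - real n) * (2 * (real m * real n)))"
    by (rule isosceles_exists)
  then have "(A, B, C) \<in> family2 L m n" by (simp add: family2_def)
  then show ?thesis by blast
qed

theorem theorem1:
  "S = F1 \<union> F2 \<and>
   (\<forall>K m n. 0 < K \<and> admissible m n \<longrightarrow>
      family1 K m n \<noteq> {} \<and>
      (\<forall>(A, B, C) \<in> family1 K m n.
         exradius A B C = real K * real m * ((real m)\<^sup>2 - (real n)\<^sup>2) \<and>
         exradius B C A = 2 * real K * real m * (real n)\<^sup>2 \<and>
         exradius C A B = 2 * real K * real m * (real n)\<^sup>2)) \<and>
   (\<forall>L m n. 0 < L \<and> admissible m n \<longrightarrow>
      family2 L m n \<noteq> {} \<and>
      (\<forall>(A, B, C) \<in> family2 L m n.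
         exradius A B C = 2 * real L * real m * real n * (real m + real n) \<and>
         exradius B C A = real L * (real m + real n) * (real m - real n)\<^sup>2 \<and>
         exradius C A B = real L * (real m + real n) * (real m - real n)\<^sup>2))"
  using S_subset_families F1_subset_S F2_subset_S
  by (auto simp: family1_nonempty family2_nonempty
      dest: family1_measures(2-4) family2_measures(2-4))

end
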